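(* For every integer $n\ge 2$, $$ \sum_{j=1}^{n-1}B_j B_{n-j}=\sum_{m=0}^{\lfloor (n-1)/2\rfloor}(n-2 m-1)B_{n-2 m-1}\,. $$
   Context: The balancing numbers $B_n$ are defined by $B_0=0$, $B_1=1$ and $B_n=6B_{n-1}-B_{n-2}$ for $n\ge 2$. *)

theory Defs
  imports Main
begin

fun balancing :: "nat \<Rightarrow> int" where
  "balancing 0 = 0"
| "balancing (Suc 0) = 1"
| "balancing (Suc (Suc n)) = 6 * balancing (Suc n) - balancing n"

end

theory Submission
  imports Defs
begin

text \<open>The identity B(a+1) B(b+1) - B(a) B(b) = B(a+b+1), summed along a + b = n, shows that the
  self-convolution S of the balancing numbers satisfies S(n+2) = S(n) + (n+1) B(n+1). The right-hand
  side of the theorem obeys the same two-step recurrence.\<close>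

text \<open>For fixed \<open>b\<close>, both sides as sequences in \<open>a\<close> obey the
  recurrence x(a+2) = 6 x(a+1) - x(a), so agreement at \<open>a = 0\<close> and \<open>a = 1\<close>
  suffices.\<close>

lemma balancing_Suc_mult_Suc:
  "balancing (Suc a) * balancing (Suc b) = balancing a * balancing b + balancing (Suc (a + b))"
proof (induction a arbitrary: b rule: balancing.induct)
  case (3 a)
  from "3.IH"(1)[of b] "3.IH"(2)[of b] show ?case
    by (simp add: algebra_simps)
qed auto

lemma balancing_convolution_step:
  "(\<Sum>j\<le>Suc (Suc n). balancing j * balancing (Suc (Suc n) - j)) =
    (\<Sum>j\<le>n. balancing j * balancing (n - j)) + int (Suc n) * balancing (Suc n)"
proof -
  have "(\<Sum>j\<le>Suc (Suc n). balancing j * balancing (Suc (Suc n) - j)) =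
      (\<Sum>j\<le>n. balancing (Suc j) * balancing (Suc n - j))"
    \<comment> \<open>The terms at both ends of the range vanish because each has a factor
      \<open>balancing 0\<close>.\<close>
    by (subst sum.atMost_Suc_shift) simp
  also have "\<dots> = (\<Sum>j\<le>n. balancing j * balancing (n - j) + balancing (Suc n))"
  proof (rule sum.cong[OF refl])
    fix j assume "j \<in> {..n}"
    then show "balancing (Suc j) * balancing (Suc n - j) =
        balancing j * balancing (n - j) + balancing (Suc n)"
      using balancing_Suc_mult_Suc[of j "n - j"] by (simp add: Suc_diff_le)
  qed
  finally show ?thesis
    by (simp add: sum.distrib)
qed

text \<open>Summing over all \<open>j \<le> n\<close> adds only zero terms and makes the identity
  valid from \<open>n = 0\<close> on: for \<open>n = 0\<close> and \<open>n = 1\<close> both sides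
  are 0, which starts the two-step induction.\<close>

lemma balancing_convolution:
  "(\<Sum>j\<le>n. balancing j * balancing (n - j)) =
    (\<Sum>m = 0..(n - 1) div 2. int (n - 2 * m - 1) * balancing (n - 2 * m - 1))"
proof (induction n rule: balancing.induct)
  case (3 n)
  let ?g = "\<lambda>m. int (n - 2 * m - 1) * balancing (n - 2 * m - 1)"
  have "(\<Sum>m = 0..(Suc (Suc n) - 1) div 2.
        int (Suc (Suc n) - 2 * m - 1) * balancing (Suc (Suc n) - 2 * m - 1)) =
      int (Suc n) * balancing (Suc n) + (\<Sum>m = 0..(n - 1) div 2. ?g m)"
  \<comment> \<open>For \<open>n > 0\<close> the term \<open>m = 0\<close> is split off and the
    shift from \<open>m\<close> to \<open>Suc m\<close> gives \<open>?g\<close>. For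
    \<open>n = 0\<close> the upper bound does not grow, since truncated subtraction makes both
    bounds 0, but then \<open>?g 0 = 0\<close>.\<close>
  proof (cases n)
    case (Suc k)
    then have "(Suc (Suc n) - 1) div 2 = Suc ((n - 1) div 2)"
      by simp
    then show ?thesis
      by (simp add: sum.atLeast0_atMost_Suc_shift algebra_simps del: sum.cl_ivl_Suc balancing.simps)
  qed simp
  with "3.IH"(2) show ?case
    by (simp only: balancing_convolution_step)
qed simp_all

theorem theorem4:
  fixes n :: nat
  assumes "n \<ge> 2"
  shows "(\<Sum>j = 1..n - 1. balancing j * balancing (n - j)) =
    (\<Sum>m = 0..(n - 1) div 2. int (n - 2 * m - 1) * balancing (n - 2 * m - 1))"
proof -
  have "(\<Sum>j = 1..n - 1. balancing j * balancing (n - j)) =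
      (\<Sum>j\<le>n. balancing j * balancing (n - j))"
  proof (rule sum.mono_neutral_left)
    show "\<forall>j \<in> {..n} - {1..n - 1}. balancing j * balancing (n - j) = 0"
    proof
      fix j assume "j \<in> {..n} - {1..n - 1}"
      then have "j = 0 \<or> j = n" by auto
      then show "balancing j * balancing (n - j) = 0" by auto
    qed
  qed auto
  then show ?thesis
    by (simp only: balancing_convolution)
qed

end
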